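(* Let $L_n$ be as in the context and $n\ge 2$. Every normal automorphism of $L_n$ is inner, where an automorphism is normal if it maps every normal subgroup onto itself.
   Context: For $n\ge 2$, $L_n=\langle y_1,\dots,y_{n-1}\mid y_j^2=1\ (1\le j\le n-1),\ y_iy_{i+1}y_i=y_{i+1}y_iy_{i+1}\ (1\le i\le n-2)\rangle$ (no relations between $y_i,y_j$ with $|i-j|\ge 2$). *)

theory Defs
  imports "HOL-Algebra.Algebra"
begin

text \<open>The group L_n given by the presentation with generators y_1..y_(n-1),
  relations y_j^2 = 1 and the braid relations y_i y_(i+1) y_i = y_(i+1) y_i y_(i+1).
  Since all generators are involutions, every element is represented by a positive word,
  i.e. a list of generator indices in {1..<n}. Two words represent the same element iff
  they are related by the smallest equivalence relation on words that is closed under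
  inserting/deleting a relator in context.\<close>

definition Lwords :: "nat \<Rightarrow> nat list set" where
  "Lwords n = {w. set w \<subseteq> {1..<n}}"

inductive_set Lrel :: "nat \<Rightarrow> (nat list \<times> nat list) set" for n :: nat where
  refl: "w \<in> Lwords n \<Longrightarrow> (w, w) \<in> Lrel n"
| sym: "(u, v) \<in> Lrel n \<Longrightarrow> (v, u) \<in> Lrel n"
| trans: "(u, v) \<in> Lrel n \<Longrightarrow> (v, w) \<in> Lrel n \<Longrightarrow> (u, w) \<in> Lrel n"
| invol: "u \<in> Lwords n \<Longrightarrow> v \<in> Lwords n \<Longrightarrow> 1 \<le> j \<Longrightarrow> j \<le> n - 1 \<Longrightarrow>
     (u @ [j, j] @ v, u @ v) \<in> Lrel n"
| braid: "u \<in> Lwords n \<Longrightarrow> v \<in> Lwords n \<Longrightarrow> 1 \<le> i \<Longrightarrow> i \<le> n - 2 \<Longrightarrow>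
     (u @ [i, Suc i, i] @ v, u @ [Suc i, i, Suc i] @ v) \<in> Lrel n"

definition Lgrp :: "nat \<Rightarrow> nat list set monoid" where
  "Lgrp n = \<lparr> carrier = Lwords n // Lrel n,
              monoid.mult = (\<lambda>A B. \<Union>a\<in>A. \<Union>b\<in>B. Lrel n `` {a @ b}),
              one = Lrel n `` {[]} \<rparr>"

definition normal_automorphism :: "('a, 'b) monoid_scheme \<Rightarrow> ('a \<Rightarrow> 'a) \<Rightarrow> bool" where
  "normal_automorphism G \<phi> \<longleftrightarrow>
     \<phi> \<in> iso G G \<and> (\<forall>N. N \<lhd> G \<longrightarrow> \<phi> ` N = N)"

definition inner_automorphism :: "('a, 'b) monoid_scheme \<Rightarrow> ('a \<Rightarrow> 'a) \<Rightarrow> bool" where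
  "inner_automorphism G \<phi> \<longleftrightarrow>
     (\<exists>g\<in>carrier G. \<forall>x\<in>carrier G. \<phi> x = g \<otimes>\<^bsub>G\<^esub> x \<otimes>\<^bsub>G\<^esub> inv\<^bsub>G\<^esub> g)"

end

(* Conjugating the dihedral groups generated by consecutive generators so that they share the
   involution y = y_1 turns L_n into F x| <y>, where F is the free product of n - 2 groups <c_i> of
   order three and y inverts every c_i.  An element of F inverted by y is a palindrome in the
   letters c_i, c_i^-1.  Since a normal automorphism preserves F, it maps y to a palindrome times y,
   which is a conjugate of y; so we may assume that it fixes y.  Then c_i is sent to a palindrome of
   order three, which must be a single letter.  The kernels of endomorphisms fixing y and mapping
   letters to letters or 1 show that this letter is c_i or c_i^-1, with the same sign for all i.
   Hence the automorphism is the identity or conjugation by y. *)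

theory Submission
  imports Defs
begin

section \<open>Reduced words\<close>

text \<open>A pair \<open>(i, True)\<close> encodes \<open>c i\<close> and \<open>(i, False)\<close>
  its inverse. Inverting every letter without reversing the order is what conjugation by
  \<open>y\<close> does to a word.\<close>

definition flip :: "('i \<times> bool) list \<Rightarrow> ('i \<times> bool) list" where
  "flip = map (\<lambda>a. (fst a, \<not> snd a))"

text \<open>Adjacent indices must differ, whatever the signs: in a group of order three the square
  of a letter is its inverse, so a syllable is always a single letter.\<close>

definition reduced :: "('i \<times> bool) list \<Rightarrow> bool" where
  "reduced w \<longleftrightarrow> distinct_adj (map fst w)"

text \<open>This models left multiplication by a letter in a free product of groups of order three,
  where a square is an inverse.\<close>

fun cons_red :: "'i \<times> bool \<Rightarrow> ('i \<times> bool) list \<Rightarrow> ('i \<times> bool) list" where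
  "cons_red a [] = [a]"
| "cons_red a (b # w) =
     (if fst a \<noteq> fst b then a # b # w
      else if snd a = snd b then (fst a, \<not> snd a) # w else w)"

lemma reduced_Nil [simp]: "reduced []"
  by (simp add: reduced_def)

lemma reduced_Cons: "reduced (a # w) \<longleftrightarrow> w = [] \<or> fst a \<noteq> fst (hd w) \<and> reduced w"
  by (cases w) (auto simp: reduced_def)

lemma reduced_append:
  "reduced (u @ v) \<longleftrightarrow>
     reduced u \<and> reduced v \<and> (u = [] \<or> v = [] \<or> fst (last u) \<noteq> fst (hd v))"
  by (auto simp: reduced_def distinct_adj_append_iff last_map hd_map)

lemma reduced_rev [simp]: "reduced (rev w) = reduced w"
  by (simp add: reduced_def flip: rev_map)

lemma flip_Nil [simp]: "flip [] = []"
  and flip_Cons [simp]: "flip (a # w) = (fst a, \<not> snd a) # flip w"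
  by (simp_all add: flip_def)

lemma flip_flip [simp]: "flip (flip w) = w"
  by (induction w) auto

lemma flip_rev: "flip (rev w) = rev (flip w)"
  by (simp add: flip_def rev_map)

lemma map_fst_flip [simp]: "map fst (flip w) = map fst w"
  by (induction w) auto

lemma fst_set_flip [simp]: "fst ` set (flip w) = fst ` set w"
  by (induction w) auto

lemma reduced_flip [simp]: "reduced (flip w) = reduced w"
  by (simp add: reduced_def)

lemma cons_red_reduced: "reduced (a # w) \<Longrightarrow> cons_red a w = a # w"
  by (cases w) (auto simp: reduced_Cons)

lemma reduced_cons_red [simp]: "reduced w \<Longrightarrow> reduced (cons_red a w)"
  by (cases w) (auto simp: reduced_Cons)

lemma fst_set_cons_red: "fst ` set (cons_red a w) \<subseteq> insert (fst a) (fst ` set w)"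
  by (cases w) auto

lemma flip_cons_red: "flip (cons_red a w) = cons_red (fst a, \<not> snd a) (flip w)"
  by (cases w) auto

text \<open>If the first multiplication deletes the head of \<open>w\<close>, reducedness makes the
  second one prepend its letter instead of merging it with the next.\<close>

lemma cons_red_twice:
  assumes "reduced w"
  shows "cons_red (i, s) (cons_red (i, s) w) = cons_red (i, \<not> s) w"
proof (cases w)
  case (Cons b v)
  then show ?thesis using assms by (cases v; cases b) (auto simp: reduced_Cons)
qed auto

lemma cons_red_cancel:
  assumes "reduced w"
  shows "cons_red (i, s) (cons_red (i, \<not> s) w) = w"
proof (cases w)
  case (Cons b v)
  then show ?thesis using assms by (cases v; cases b) (auto simp: reduced_Cons)
qed auto

text \<open>A palindrome of even positive length has two equal letters in the middle, which a
  reduced word cannot have; odd length leaves a middle letter.\<close>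

lemma reduced_palindrome_cases:
  assumes "reduced w" "rev w = w"
  obtains "w = []" | u a where "w = u @ a # rev u"
proof (cases "even (length w)")
  case True
  define u where "u = take (length w div 2) w"
  define v where "v = drop (length w div 2) w"
  have w: "w = u @ v" by (simp add: u_def v_def)
  have "length u = length v" using True by (auto simp: u_def v_def)
  then have v: "v = rev u" using assms(2) by (simp add: w)
  then have "u = []" using assms(1) by (cases u rule: rev_cases) (auto simp: w reduced_append reduced_Cons)
  with w v that(1) show thesis by simp
next
  case False
  define u where "u = take (length w div 2) w"
  define v where "v = drop (length w div 2) w"
  have w: "w = u @ v" by (simp add: u_def v_def)
  have len: "length v = Suc (length u)" using False by (auto simp: u_def v_def elim!: oddE)
  then obtain a v' where v: "v = a # v'" by (cases v) auto
  have "rev v' @ (a # rev u) = u @ (a # v')" using assms(2) by (simp add: w v)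
  then have "v' = rev u" using len v by (subst (asm) append_eq_append_conv) auto
  with w v that(2) show thesis by simp
qed

section \<open>An involution inverting elements with trivial cube, and the values of words\<close>

lemma (in group) mult_inv_cancel_left [simp]:
  "g \<in> carrier G \<Longrightarrow> x \<in> carrier G \<Longrightarrow> g \<otimes> (inv g \<otimes> x) = x"
  "g \<in> carrier G \<Longrightarrow> x \<in> carrier G \<Longrightarrow> inv g \<otimes> (g \<otimes> x) = x"
  by (simp_all flip: m_assoc)

text \<open>Only relations are recorded here; the \<open>c i\<close> may coincide or be trivial. So
  the locale describes the group under study and also the possible targets of homomorphisms from
  it.\<close>

locale inverted_letters = group G for G (structure) +
  fixes I :: "'i set" and y :: 'a and c :: "'i \<Rightarrow> 'a"
  assumes y_closed [simp]: "y \<in> carrier G"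
    and c_closed [simp]: "i \<in> I \<Longrightarrow> c i \<in> carrier G"
    and y_y [simp]: "y \<otimes> y = \<one>"
    and c_cube: "i \<in> I \<Longrightarrow> c i \<otimes> c i \<otimes> c i = \<one>"
    and y_c_y: "i \<in> I \<Longrightarrow> y \<otimes> c i \<otimes> y = inv (c i)"
begin

definition letter :: "'i \<times> bool \<Rightarrow> 'a" where
  "letter a = (if snd a then c (fst a) else inv (c (fst a)))"

definition ev :: "('i \<times> bool) list \<Rightarrow> 'a" where
  "ev w = foldr (\<lambda>a x. letter a \<otimes> x) w \<one>"

abbreviation words :: "('i \<times> bool) list set" where
  "words \<equiv> {w. fst ` set w \<subseteq> I}"

lemma inv_y [simp]: "inv y = y"
  by (simp add: inv_equality)

lemma y_y_left [simp]: "x \<in> carrier G \<Longrightarrow> y \<otimes> (y \<otimes> x) = x"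
  by (simp flip: m_assoc)

lemma letter_closed [simp]: "fst a \<in> I \<Longrightarrow> letter a \<in> carrier G"
  by (simp add: letter_def)

lemma ev_Nil [simp]: "ev [] = \<one>"
  by (simp add: ev_def)

lemma ev_Cons [simp]: "ev (a # w) = letter a \<otimes> ev w"
  by (simp add: ev_def)

lemma ev_closed [simp]: "w \<in> words \<Longrightarrow> ev w \<in> carrier G"
  by (induction w) auto

lemma ev_append: "u \<in> words \<Longrightarrow> v \<in> words \<Longrightarrow> ev (u @ v) = ev u \<otimes> ev v"
  by (induction u) (auto simp: m_assoc)

lemma inv_letter: "fst a \<in> I \<Longrightarrow> inv (letter a) = letter (fst a, \<not> snd a)"
  by (simp add: letter_def)

lemma letter_twice:
  assumes "fst a \<in> I"
  shows "letter a \<otimes> letter a = letter (fst a, \<not> snd a)"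
proof -
  have sq: "c (fst a) \<otimes> c (fst a) = inv (c (fst a))"
    using c_cube[of "fst a"] assms by (metis c_closed inv_equality m_closed inv_inv)
  then have "inv (c (fst a)) \<otimes> inv (c (fst a)) = c (fst a)"
    using assms by (metis c_closed inv_mult_group inv_inv)
  with sq show ?thesis by (simp add: letter_def)
qed

lemma letter_cancel: "fst a \<in> I \<Longrightarrow> letter a \<otimes> letter (fst a, \<not> snd a) = \<one>"
  and letter_cancel': "fst a \<in> I \<Longrightarrow> letter (fst a, \<not> snd a) \<otimes> letter a = \<one>"
  by (simp_all flip: inv_letter)

lemma y_letter:
  assumes "fst a \<in> I"
  shows "y \<otimes> letter a = letter (fst a, \<not> snd a) \<otimes> y"
proof -
  have 1: "y \<otimes> c (fst a) = inv (c (fst a)) \<otimes> y"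
    using y_c_y[OF assms] assms
    by (metis c_closed inv_closed inv_solve_right inv_y m_closed y_closed)
  have "c (fst a) \<otimes> y = y \<otimes> (y \<otimes> c (fst a)) \<otimes> y" using assms by simp
  also have "\<dots> = y \<otimes> inv (c (fst a))" unfolding 1 using assms by (simp add: m_assoc)
  finally show ?thesis using 1 by (simp add: letter_def)
qed

lemma y_ev: "w \<in> words \<Longrightarrow> y \<otimes> ev w = ev (flip w) \<otimes> y"
proof (induction w)
  case (Cons a w)
  have "y \<otimes> ev (a # w) = y \<otimes> letter a \<otimes> ev w" using Cons.prems by (simp add: m_assoc)
  also have "\<dots> = letter (fst a, \<not> snd a) \<otimes> (y \<otimes> ev w)"
    using Cons.prems by (simp add: y_letter m_assoc)
  also have "\<dots> = ev (flip (a # w)) \<otimes> y"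
    using Cons by (simp add: m_assoc)
  finally show ?case .
qed simp

lemma inv_ev: "w \<in> words \<Longrightarrow> inv (ev w) = ev (rev (flip w))"
proof (induction w)
  case (Cons a w)
  then show ?case
    by (simp add: inv_mult_group ev_append inv_letter)
qed simp

lemma ev_cons_red:
  assumes "fst a \<in> I" "w \<in> words"
  shows "ev (cons_red a w) = letter a \<otimes> ev w"
proof (cases w)
  case (Cons b v)
  consider "fst a \<noteq> fst b" | "a = b" | "b = (fst a, \<not> snd a)"
    by (cases a; cases b) auto
  then show ?thesis
    using assms Cons
    by cases (auto simp: letter_twice letter_cancel simp flip: m_assoc)
qed simp

text \<open>The elements with such a form make up a set \<open>T\<close> that contains
  \<open>\<one>\<close> and is stable under left multiplication by \<open>y\<close> and by letters
  of either sign. Uniqueness has to wait for freeness, see \<open>ev_inj\<close>.\<close>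

lemma generate_normal_form:
  assumes "x \<in> generate G (insert y (c ` I))"
  obtains w where "w \<in> words" "reduced w" "x = ev w \<or> x = ev w \<otimes> y"
proof -
  define T where "T = {x. \<exists>w\<in>words. reduced w \<and> (x = ev w \<or> x = ev w \<otimes> y)}"
  have T: "T \<subseteq> carrier G" by (auto simp: T_def)
  have y: "y \<otimes> t \<in> T" if "t \<in> T" for t
  proof -
    from that obtain w where w: "w \<in> words" "reduced w" "t = ev w \<or> t = ev w \<otimes> y"
      by (auto simp: T_def)
    then have w': "flip w \<in> words" "reduced (flip w)" by simp_all
    from w(3) have "y \<otimes> t = ev (flip w) \<otimes> y \<or> y \<otimes> t = ev (flip w)"
    proof
      assume "t = ev w \<otimes> y"
      then have "y \<otimes> t = y \<otimes> ev w \<otimes> y" using ev_closed[OF w(1)] by (simp add: m_assoc)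
      then show ?thesis using ev_closed[OF w'(1)] by (simp add: y_ev[OF w(1)] m_assoc)
    qed (simp add: y_ev[OF w(1)])
    with w' show ?thesis unfolding T_def by blast
  qed
  have l: "letter a \<otimes> t \<in> T" if "t \<in> T" "fst a \<in> I" for t a
  proof -
    from that(1) obtain w where w: "w \<in> words" "reduced w" "t = ev w \<or> t = ev w \<otimes> y"
      by (auto simp: T_def)
    have "cons_red a w \<in> words" "reduced (cons_red a w)"
      using w(1,2) that(2) subset_trans[OF fst_set_cons_red[of a w]] by simp_all
    moreover have "letter a \<otimes> t = ev (cons_red a w) \<or> letter a \<otimes> t = ev (cons_red a w) \<otimes> y"
      using w(3) ev_closed[OF w(1)] that(2) by (auto simp: ev_cons_red[OF that(2) w(1)] m_assoc)
    ultimately show ?thesis unfolding T_def by blast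
  qed
  \<comment> \<open>Stability of \<open>T\<close> under left multiplication by \<open>x\<close>
    passes to products, so it is the statement to induct on; applied to \<open>\<one>\<close> it
    puts \<open>x\<close> into \<open>T\<close>.\<close>
  have "x \<in> carrier G \<and> (\<forall>t\<in>T. x \<otimes> t \<in> T)"
    using assms
  proof (induction rule: generate.induct)
    case one
    then show ?case using T by auto
  next
    case (incl h)
    then show ?case using y l[of _ "(i, True)" for i] by (auto simp: letter_def)
  next
    case (inv h)
    then show ?case using y l[of _ "(i, False)" for i] by (auto simp: letter_def)
  next
    case (eng h1 h2)
    then show ?case using T by (auto simp: m_assoc subset_iff)
  qed
  moreover have "\<one> \<in> T" unfolding T_def by (auto intro!: exI[of _ "[]"])
  ultimately have "x \<in> T" by (metis r_one)
  then show thesis using that by (auto simp: T_def)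
qed

lemma hom_ev:
  assumes "inverted_letters H I y' c'" "h \<in> hom G H" "\<And>i. i \<in> I \<Longrightarrow> h (c i) = c' i" "w \<in> words"
  shows "h (ev w) = inverted_letters.ev H c' w"
proof -
  interpret H: inverted_letters H I y' c' by fact
  interpret group_hom G H h using assms(2) by unfold_locales
  show ?thesis using assms(4)
    by (induction w) (auto simp: letter_def H.letter_def assms(3))
qed

end

text \<open>Van der Waerden's trick: the abstract letters act on reduced words by left multiplication,
  which separates reduced words without ever multiplying two of them.\<close>

abbreviation red_perms :: "(('i \<times> bool) list \<Rightarrow> ('i \<times> bool) list) monoid" where
  "red_perms \<equiv> BijGroup (Collect reduced)"

text \<open>Restriction makes the map extensional, as \<open>BijGroup\<close> demands; likewise for
  \<open>red_c\<close>.\<close>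

definition red_y :: "('i \<times> bool) list \<Rightarrow> ('i \<times> bool) list" where
  "red_y = restrict flip (Collect reduced)"

definition red_c :: "'i \<Rightarrow> ('i \<times> bool) list \<Rightarrow> ('i \<times> bool) list" where
  "red_c i = restrict (cons_red (i, True)) (Collect reduced)"

lemma red_y_Bij: "red_y \<in> Bij (Collect reduced)"
proof -
  have "bij_betw flip (Collect reduced) (Collect reduced)"
    by (rule bij_betw_byWitness[of _ flip]) auto
  then show ?thesis by (simp add: Bij_def red_y_def)
qed

lemma cons_red_Bij: "restrict (cons_red (i, s)) (Collect reduced) \<in> Bij (Collect reduced)"
proof -
  have "bij_betw (cons_red (i, s)) (Collect reduced) (Collect reduced)"
    using cons_red_cancel[of _ i s] cons_red_cancel[of _ i "\<not> s"]
    by (intro bij_betw_byWitness[of _ "cons_red (i, \<not> s)"]) auto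
  then show ?thesis by (simp add: Bij_def)
qed

lemma red_perms_carrier: "carrier red_perms = Bij (Collect reduced)"
  and red_perms_one: "\<one>\<^bsub>red_perms\<^esub> = restrict (\<lambda>w. w) (Collect reduced)"
  by (simp_all add: BijGroup_def)

lemma red_perms_mult:
  "f \<in> Bij (Collect reduced) \<Longrightarrow> g \<in> Bij (Collect reduced) \<Longrightarrow>
     f \<otimes>\<^bsub>red_perms\<^esub> g = compose (Collect reduced) f g"
  by (simp add: BijGroup_def)

lemma inv_red_c:
  "inv\<^bsub>red_perms\<^esub> (red_c i) = restrict (cons_red (i, False)) (Collect reduced)"
proof (rule group.inv_equality[OF group_BijGroup])
  show "restrict (cons_red (i, False)) (Collect reduced) \<otimes>\<^bsub>red_perms\<^esub> red_c i = \<one>\<^bsub>red_perms\<^esub>"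
    unfolding red_c_def using cons_red_cancel[of _ i False]
    by (subst red_perms_mult) (auto simp: cons_red_Bij BijGroup_def compose_def fun_eq_iff)
qed (use cons_red_Bij in \<open>auto simp: BijGroup_def red_c_def\<close>)

text \<open>The cube relation comes from \<open>cons_red_twice\<close> and
  \<open>cons_red_cancel\<close>, the inversion by \<open>y\<close> from
  \<open>flip_cons_red\<close>.\<close>

lemma red_inverted_letters: "inverted_letters red_perms I red_y red_c"
proof -
  interpret group red_perms by (rule group_BijGroup)
  note c = cons_red_Bij[of _ True, folded red_c_def]
  show "inverted_letters red_perms I red_y red_c"
  proof
    show "red_y \<otimes>\<^bsub>red_perms\<^esub> red_y = \<one>\<^bsub>red_perms\<^esub>"
      by (simp add: red_perms_mult red_y_Bij)
        (auto simp: red_y_def BijGroup_def compose_def fun_eq_iff)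
    show "red_c i \<otimes>\<^bsub>red_perms\<^esub> red_c i \<otimes>\<^bsub>red_perms\<^esub> red_c i = \<one>\<^bsub>red_perms\<^esub>" for i
      using cons_red_cancel[of _ i True]
      by (simp add: red_perms_mult compose_Bij c)
        (auto simp: red_c_def BijGroup_def compose_def fun_eq_iff cons_red_twice)
    show "red_y \<otimes>\<^bsub>red_perms\<^esub> red_c i \<otimes>\<^bsub>red_perms\<^esub> red_y = inv\<^bsub>red_perms\<^esub> (red_c i)" for i
      by (simp add: red_perms_mult compose_Bij c red_y_Bij inv_red_c)
        (auto simp: red_y_def red_c_def compose_def fun_eq_iff flip_cons_red)
  qed (auto simp: BijGroup_def red_y_Bij c)
qed

text \<open>While a reduced word is built up from the right, each multiplication merely prepends its
  letter. Hence the action on the empty word recovers the word.\<close>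

lemma red_ev_Nil:
  fixes w :: "('i \<times> bool) list"
  assumes "reduced w"
  shows "inverted_letters.ev red_perms red_c w [] = w"
proof -
  interpret red: inverted_letters red_perms "UNIV :: 'i set" red_y red_c by (rule red_inverted_letters)
  show ?thesis
    using assms
  proof (induction w)
    case Nil
    then show ?case by (simp add: red_perms_one)
  next
    case (Cons a w)
    have a: "red.letter a = restrict (cons_red a) (Collect reduced)"
      by (cases "snd a"; cases a) (simp_all add: red.letter_def inv_red_c, simp add: red_c_def)
    have w: "reduced w" using Cons.prems by (cases w) (auto simp: reduced_Cons)
    have ew: "red.ev w \<in> Bij (Collect reduced)"
      using red.ev_closed[of w] by (simp add: red_perms_carrier)
    have la: "red.letter a \<in> Bij (Collect reduced)"
      using red.letter_closed[of a] by (simp add: red_perms_carrier)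
    have "red.ev (a # w) [] = red.letter a (red.ev w [])"
      by (simp add: red_perms_mult[OF la ew] compose_def)
    also have "\<dots> = cons_red a w"
      using Cons.IH[OF w] w by (simp add: a)
    finally show ?case using Cons.prems by (simp add: cons_red_reduced)
  qed
qed

section \<open>Normal automorphisms\<close>

text \<open>An elementwise form of normality, which survives composition with conjugations and
  applies directly to kernels.\<close>

definition preserves_normal :: "('a, 'b) monoid_scheme \<Rightarrow> ('a \<Rightarrow> 'a) \<Rightarrow> bool" where
  "preserves_normal G \<psi> \<longleftrightarrow>
     \<psi> \<in> hom G G \<and> (\<forall>N x. N \<lhd> G \<longrightarrow> x \<in> carrier G \<longrightarrow> \<psi> x \<in> N \<longleftrightarrow> x \<in> N)"

lemma (in group) normal_automorphism_preserves_normal: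
  assumes "normal_automorphism G \<phi>"
  shows "preserves_normal G \<phi>"
proof -
  have iso: "\<phi> \<in> iso G G" and N: "\<And>N. N \<lhd> G \<Longrightarrow> \<phi> ` N = N"
    using assms by (auto simp: normal_automorphism_def)
  have inj: "inj_on \<phi> (carrier G)" using iso by (auto simp: iso_def bij_betw_def)
  have "\<phi> x \<in> N \<longleftrightarrow> x \<in> N" if "N \<lhd> G" "x \<in> carrier G" for N x
    using inj_on_image_mem_iff[OF inj that(2) normal_imp_subgroup[OF that(1), THEN subgroup.subset]]
      N[OF that(1)] by simp
  then show ?thesis using iso by (auto simp: preserves_normal_def iso_def)
qed

text \<open>Divides out an inner automorphism, which later allows \<open>y\<close> to be assumed
  fixed.\<close>

lemma (in group) preserves_normal_conj:
  assumes "preserves_normal G \<phi>" "g \<in> carrier G"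
  shows "preserves_normal G (\<lambda>x. inv g \<otimes> \<phi> x \<otimes> g)"
proof -
  have hom: "\<phi> \<in> hom G G" using assms by (simp add: preserves_normal_def)
  then have cl: "\<phi> x \<in> carrier G" if "x \<in> carrier G" for x using that by (rule hom_in_carrier)
  have "inv g \<otimes> \<phi> (x \<otimes> x') \<otimes> g = inv g \<otimes> \<phi> x \<otimes> g \<otimes> (inv g \<otimes> \<phi> x' \<otimes> g)"
    if "x \<in> carrier G" "x' \<in> carrier G" for x x'
    using assms(2) cl that by (simp add: hom_mult[OF hom] m_assoc)
  moreover have "inv g \<otimes> \<phi> x \<otimes> g \<in> N \<longleftrightarrow> x \<in> N" if N: "N \<lhd> G" and x: "x \<in> carrier G" for N x
  proof
    assume "inv g \<otimes> \<phi> x \<otimes> g \<in> N"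
    then have "g \<otimes> (inv g \<otimes> \<phi> x \<otimes> g) \<otimes> inv g \<in> N"
      using normal.inv_op_closed2[OF N assms(2)] by simp
    then have "\<phi> x \<in> N" using assms(2) cl[OF x] by (simp add: m_assoc)
    then show "x \<in> N" using assms(1) N x by (simp add: preserves_normal_def)
  next
    assume "x \<in> N"
    then have "\<phi> x \<in> N" using assms(1) N x by (simp add: preserves_normal_def)
    then show "inv g \<otimes> \<phi> x \<otimes> g \<in> N" by (rule normal.inv_op_closed1[OF N assms(2)])
  qed
  ultimately show ?thesis using cl assms(2)
    by (auto simp: preserves_normal_def intro!: homI)
qed

text \<open>This is the case of the normal subgroup \<open>kernel G G f\<close>. All constraints on
  \<open>\<psi>\<close> below are obtained from kernels of well-chosen endomorphisms
  \<open>f\<close>.\<close>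

lemma (in group) preserves_normal_hom_eq_one:
  assumes "preserves_normal G \<psi>" "f \<in> hom G G" "x \<in> carrier G"
  shows "f (\<psi> x) = \<one> \<longleftrightarrow> f x = \<one>"
proof -
  interpret f: group_hom G G f using assms(2) by unfold_locales
  have "\<psi> x \<in> carrier G" using assms(1,3) by (auto simp: preserves_normal_def hom_def)
  moreover have "\<psi> x \<in> kernel G G f \<longleftrightarrow> x \<in> kernel G G f"
    using assms(1,3) f.normal_kernel by (simp add: preserves_normal_def)
  ultimately show ?thesis using assms(3) by (simp add: kernel_def)
qed

text \<open>The semidirect product of a free product of groups of order three with the inverting
  involution \<open>y\<close>. A locale cannot quantify over target groups of all types, so the
  universal property is stated for two targets: \<open>red_perms\<close>, which separates words, and
  the group itself, which supplies endomorphisms.\<close>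

locale free_inverted_letters = inverted_letters +
  assumes generates: "carrier G = generate G (insert y (c ` I))"
    and acts: "\<exists>\<rho>\<in>hom G red_perms. \<rho> y = red_y \<and> (\<forall>i\<in>I. \<rho> (c i) = red_c i)"
    and extends: "inverted_letters G I y d \<Longrightarrow> \<exists>f\<in>hom G G. f y = y \<and> (\<forall>i\<in>I. f (c i) = d i)"
begin

section \<open>Unique normal forms and endomorphisms in the free case\<close>

lemma ev_inj:
  assumes "w \<in> words" "w' \<in> words" "reduced w" "reduced w'" "ev w = ev w'"
  shows "w = w'"
proof -
  obtain \<rho> where \<rho>: "\<rho> \<in> hom G red_perms" "\<And>i. i \<in> I \<Longrightarrow> \<rho> (c i) = red_c i"
    using acts by auto
  have "\<rho> (ev v) [] = v" if "v \<in> words" "reduced v" for v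
    using hom_ev[OF red_inverted_letters \<rho> that(1)] red_ev_Nil[OF that(2)] by simp
  then show ?thesis using assms by metis
qed

lemma ev_eq_one: "w \<in> words \<Longrightarrow> reduced w \<Longrightarrow> ev w = \<one> \<longleftrightarrow> w = []"
  using ev_inj[of w "[]"] by auto

lemma letter_ne_one: "fst a \<in> I \<Longrightarrow> letter a \<noteq> \<one>"
  using ev_eq_one[of "[a]"] by (simp add: reduced_Cons)

lemma y_ne_one: "y \<noteq> \<one>"
proof
  assume "y = \<one>"
  obtain \<rho> where \<rho>: "\<rho> \<in> hom G red_perms" "\<rho> y = red_y" "\<forall>i\<in>I. \<rho> (c i) = red_c i"
    using acts by auto
  interpret group_hom G red_perms \<rho>
    using \<rho>(1) by (intro group_hom.intro group_BijGroup) (unfold_locales)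
  have "\<rho> y = \<one>\<^bsub>red_perms\<^esub>" using hom_one \<open>y = \<one>\<close> by simp
  \<comment> \<open>\<open>flip\<close> changes the sign of any one-letter word; the index is
    arbitrary, so an empty \<open>I\<close> is covered too.\<close>
  then have "\<rho> y [(undefined, True)] = [(undefined, True)]"
    by (simp only:) (simp add: BijGroup_def reduced_Cons)
  then show False by (simp add: \<rho>(2) red_y_def reduced_Cons)
qed

text \<open>Both \<open>\<one>\<close> and the letters have trivial cube and are inverted by
  \<open>y\<close>, so such an assignment respects the relations.\<close>

lemma extend_hom:
  assumes "\<And>i. i \<in> I \<Longrightarrow> d i = \<one> \<or> (\<exists>a. fst a \<in> I \<and> d i = letter a)"
  obtains f where "f \<in> hom G G" "f y = y" "\<And>i. i \<in> I \<Longrightarrow> f (c i) = d i"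
proof -
  have "inverted_letters G I y d"
  proof
    fix i assume i: "i \<in> I"
    show "d i \<in> carrier G" using assms[OF i] by auto
    show "d i \<otimes> d i \<otimes> d i = \<one>"
      using assms[OF i] letter_cancel'[of "(k, s)" for k s] by (auto simp: letter_twice)
    show "y \<otimes> d i \<otimes> y = inv (d i)"
      using assms[OF i] by (auto simp: y_letter inv_letter m_assoc)
  qed auto
  then show thesis using extends that by blast
qed

text \<open>The endomorphism that kills all letters has the free product as its kernel, so its value
  on \<open>x\<close> decides whether the normal form of \<open>x\<close> ends in
  \<open>y\<close>.\<close>

lemma rotation_kernel:
  "\<exists>f\<in>hom G G. f y = y \<and> (\<forall>i\<in>I. f (c i) = \<one>) \<and>
     (\<forall>x\<in>carrier G. \<exists>w\<in>words. reduced w \<and> x = (if f x = \<one> then ev w else ev w \<otimes> y))"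
proof -
  obtain f where f: "f \<in> hom G G" "f y = y" "\<And>i. i \<in> I \<Longrightarrow> f (c i) = \<one>"
    using extend_hom[of "\<lambda>_. \<one>"] by blast
  interpret f: group_hom G G f using f(1) by unfold_locales
  have ev: "f (ev w) = \<one>" if "w \<in> words" for w
    using that by (induction w) (auto simp: letter_def f(3))
  have nf: "\<exists>w\<in>words. reduced w \<and> (x = ev w \<or> x = ev w \<otimes> y)" if "x \<in> carrier G" for x
    using generate_normal_form[of x] that generates by auto
  have y: "f (ev w \<otimes> y) \<noteq> \<one>" if "w \<in> words" for w
    using ev[OF that] ev_closed[OF that] y_ne_one by (simp add: f(2))
  have "\<exists>w\<in>words. reduced w \<and> x = (if f x = \<one> then ev w else ev w \<otimes> y)"
    if x: "x \<in> carrier G" for x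
  proof -
    obtain w where w: "w \<in> words" "reduced w" "x = ev w \<or> x = ev w \<otimes> y" using nf[OF x] by blast
    then show ?thesis using y[OF w(1)] ev[OF w(1)] by (intro bexI[of _ w]) auto
  qed
  with f show ?thesis by blast
qed

section \<open>Palindromes and the images of the generators\<close>

lemma inverted_imp_palindrome:
  assumes "w \<in> words" "reduced w" "y \<otimes> ev w \<otimes> y = inv (ev w)"
  shows "rev w = w"
proof -
  have w': "flip w \<in> words" "rev (flip w) \<in> words" using assms by simp_all
  \<comment> \<open>Conjugation by \<open>y\<close> flips the letters, inversion flips and also
    reverses them; both results are reduced, so the words agree.\<close>
  have "ev (flip w) = ev (rev (flip w))"
    using assms(3) ev_closed[OF w'(1)] by (simp add: y_ev[OF assms(1)] inv_ev[OF assms(1)] m_assoc)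
  then have "flip w = rev (flip w)" using ev_inj w' assms by simp
  then show ?thesis by (metis flip_flip flip_rev)
qed

text \<open>Otherwise \<open>w\<close> is \<open>a z a\<close> with \<open>z\<close> nonempty. In
  the cube each inner pair \<open>a a\<close> merges into the opposite letter \<open>a'\<close>, and
  \<open>a z a' z a' z a\<close> is reduced and nonempty, hence not trivial.\<close>

lemma palindrome_cube:
  assumes "w \<in> words" "reduced w" "rev w = w" "ev w \<otimes> ev w \<otimes> ev w = \<one>" "w \<noteq> []"
  shows "\<exists>a. w = [a]"
  using assms(2,3)
proof (cases rule: reduced_palindrome_cases)
  case (2 u s)
  show ?thesis
  proof (cases u)
    case Nil
    with 2 show ?thesis by simp
  next
    case (Cons a v)
    define z where "z = v @ s # rev v"
    define a' where "a' = (fst a, \<not> snd a)"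
    have w: "w = [a] @ z @ [a]" using 2 Cons by (simp add: z_def)
    have I: "fst a \<in> I" "fst a' \<in> I" "z \<in> words" using assms(1) by (auto simp: w a'_def)
    have red: "reduced (a # z @ [a'] @ z @ [a'] @ z @ [a])"
      using assms(2) unfolding w
      by (auto simp: reduced_append reduced_Cons a'_def z_def hd_append)
    have aa: "letter a \<otimes> (letter a \<otimes> x) = letter a' \<otimes> x" if "x \<in> carrier G" for x
      using that I by (simp add: a'_def letter_twice flip: m_assoc)
    have "ev w \<otimes> ev w \<otimes> ev w = ev (a # z @ [a'] @ z @ [a'] @ z @ [a])"
      using I ev_closed[OF I(3)] by (simp add: w ev_append m_assoc aa)
    then show ?thesis using ev_eq_one[OF _ red] I assms(4) by simp
  qed
qed (use assms in simp)

text \<open>The image of \<open>y\<close> lies outside the free product and squares to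
  \<open>\<one>\<close>, so it is \<open>ev w \<otimes> y\<close> with \<open>ev w\<close> inverted
  by \<open>y\<close>. Then \<open>w\<close> is a palindrome, and its middle letter can be halved to
  exhibit a conjugate of \<open>y\<close>.\<close>

lemma preserves_normal_y:
  assumes "preserves_normal G \<psi>"
  shows "\<exists>g\<in>carrier G. \<psi> y = g \<otimes> y \<otimes> inv g"
proof -
  obtain f where f: "f \<in> hom G G" "f y = y" "\<forall>i\<in>I. f (c i) = \<one>"
    "\<forall>x\<in>carrier G. \<exists>w\<in>words. reduced w \<and> x = (if f x = \<one> then ev w else ev w \<otimes> y)"
    using rotation_kernel by auto
  interpret \<psi>: group_hom G G \<psi> using assms by unfold_locales (simp add: preserves_normal_def)
  have "f (\<psi> y) \<noteq> \<one>" using preserves_normal_hom_eq_one[OF assms f(1)] f(2) y_ne_one by simp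
  then obtain w where w: "w \<in> words" "reduced w" "\<psi> y = ev w \<otimes> y"
    using bspec[OF f(4), of "\<psi> y"] by auto
  note ew = ev_closed[OF w(1)]
  have "ev w \<otimes> y \<otimes> (ev w \<otimes> y) = \<one>"
    using \<psi>.hom_mult[of y y] by (simp add: w(3))
  moreover have "y \<otimes> ev w \<otimes> y = inv (ev w) \<otimes> (ev w \<otimes> y \<otimes> (ev w \<otimes> y))"
    using ew by (simp add: m_assoc)
  ultimately have "y \<otimes> ev w \<otimes> y = inv (ev w)" using ew by simp
  then have "rev w = w" using inverted_imp_palindrome w by blast
  with w(2) show ?thesis
  proof (cases rule: reduced_palindrome_cases)
    case 1
    then show ?thesis using w(3) by (intro bexI[of _ \<one>]) simp_all
  next
    case (2 u a)
    \<comment> \<open>The square root of the middle letter: one factor \<open>a'\<close> stays to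
      the left of \<open>y\<close>, the other crosses \<open>y\<close> and becomes the inverse of
      the first.\<close>
    define a' where "a' = (fst a, \<not> snd a)"
    have I: "u \<in> words" "fst a \<in> I" "fst a' \<in> I" "flip u \<in> words" "rev u \<in> words"
      using w(1) by (auto simp: 2 a'_def)
    note cl = ev_closed[OF I(1)] ev_closed[OF I(4)] ev_closed[OF I(5)]
    have a: "letter a' \<otimes> letter a' = letter a" using letter_twice[of a'] I by (simp add: a'_def)
    have inv_u: "ev (rev u) \<otimes> y = y \<otimes> inv (ev u)"
      using y_ev[of "rev (flip u)"] I by (simp add: inv_ev flip_rev)
    have inv_a: "inv (letter a') = letter a" using I by (simp add: inv_letter a'_def)
    have ay: "letter a' \<otimes> (y \<otimes> x) = y \<otimes> (letter a \<otimes> x)" if "x \<in> carrier G" for x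
    proof -
      have "letter a' \<otimes> y \<otimes> x = y \<otimes> letter a \<otimes> x" using y_letter[OF I(2)] by (simp add: a'_def)
      then show ?thesis using that I by (simp add: m_assoc)
    qed
    have "\<psi> y = ev u \<otimes> letter a \<otimes> (ev (rev u) \<otimes> y)"
      using cl I by (simp add: w(3) 2 ev_append m_assoc)
    also have "\<dots> = ev u \<otimes> (letter a' \<otimes> letter a') \<otimes> y \<otimes> inv (ev u)"
      using cl I by (simp add: inv_u a m_assoc)
    also have "\<dots> = (ev u \<otimes> letter a') \<otimes> (letter a' \<otimes> y) \<otimes> inv (ev u)"
      using cl I by (simp add: m_assoc)
    also have "\<dots> = (ev u \<otimes> letter a') \<otimes> y \<otimes> inv (ev u \<otimes> letter a')"
      using cl I by (simp add: inv_mult_group inv_a ay m_assoc)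
    finally show ?thesis using cl I by (intro bexI[of _ "ev u \<otimes> letter a'"]) simp_all
  qed
qed

lemma preserves_normal_letter:
  assumes "preserves_normal G \<psi>" "\<psi> y = y" "i \<in> I"
  shows "\<exists>s. \<psi> (c i) = letter (i, s)"
proof -
  interpret \<psi>: group_hom G G \<psi> using assms by unfold_locales (simp add: preserves_normal_def)
  note one = preserves_normal_hom_eq_one[OF assms(1)]
  have ci: "c i = letter (i, True)" by (simp add: letter_def)
  obtain f where f: "f \<in> hom G G" "f y = y" "\<forall>i\<in>I. f (c i) = \<one>"
    "\<forall>x\<in>carrier G. \<exists>w\<in>words. reduced w \<and> x = (if f x = \<one> then ev w else ev w \<otimes> y)"
    using rotation_kernel by auto
  have "f (\<psi> (c i)) = \<one>" using one[OF f(1)] f(3) assms(3) by simp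
  then obtain w where w: "w \<in> words" "reduced w" "\<psi> (c i) = ev w"
    using bspec[OF f(4), of "\<psi> (c i)"] assms(3) by auto
  have "\<psi> (y \<otimes> c i \<otimes> y) = y \<otimes> ev w \<otimes> y" using assms by (simp add: w(3))
  then have "y \<otimes> ev w \<otimes> y = inv (ev w)" using assms(3) by (simp add: y_c_y w(3))
  then have "rev w = w" using inverted_imp_palindrome w by blast
  moreover have "ev w \<otimes> ev w \<otimes> ev w = \<psi> (c i \<otimes> c i \<otimes> c i)" using assms by (simp add: w(3))
  then have "ev w \<otimes> ev w \<otimes> ev w = \<one>" using assms(3) by (simp add: c_cube)
  moreover have "w \<noteq> []"
  proof
    assume "w = []"
    \<comment> \<open>The identity has trivial kernel, so \<open>\<psi>\<close> maps no nontrivial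
      element to \<open>\<one>\<close>.\<close>
    moreover have "(\<lambda>x. x) \<in> hom G G" by (auto intro: homI)
    ultimately show False
      using one[of "\<lambda>x. x" "c i"] w(3) letter_ne_one[of "(i, True)"] assms(3) by (simp add: ci)
  qed
  ultimately obtain a where "w = [a]" using palindrome_cube w by blast
  then have a: "\<psi> (c i) = letter a" "fst a \<in> I" using w by simp_all
  have "fst a = i"
  proof (rule ccontr)
    assume ne: "fst a \<noteq> i"
    \<comment> \<open>This \<open>h\<close> kills \<open>c i\<close> but fixes every letter of
      another index, in particular the supposed image of \<open>c i\<close>.\<close>
    obtain h where h: "h \<in> hom G G" "\<And>k. k \<in> I \<Longrightarrow> h (c k) = (if k = i then \<one> else letter (k, True))"
      by (rule extend_hom[of "\<lambda>k. if k = i then \<one> else letter (k, True)"]) auto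
    interpret h: group_hom G G h using h(1) by unfold_locales
    have "h (letter a) = letter a" using h(2)[OF a(2)] ne a(2) by (auto simp: letter_def)
    moreover have "h (\<psi> (c i)) = \<one>" using one[OF h(1)] h(2) assms(3) by simp
    ultimately show False using a letter_ne_one by simp
  qed
  then show ?thesis using a(1) by (metis prod.collapse)
qed

lemma preserves_normal_letter_sign:
  assumes "preserves_normal G \<psi>" "\<psi> y = y" "i \<in> I" "j \<in> I"
    "\<psi> (c i) = letter (i, s)" "\<psi> (c j) = letter (j, t)"
  shows "s = t"
proof (rule ccontr)
  assume ne: "s \<noteq> t"
  interpret \<psi>: group_hom G G \<psi> using assms by unfold_locales (simp add: preserves_normal_def)
  have ij: "i \<noteq> j" using ne assms(3-6) ev_inj[of "[(i, s)]" "[(i, t)]"] by (auto simp: reduced_Cons)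
  \<comment> \<open>The sign \<open>k \<noteq> j\<close> sends \<open>c j\<close> to the inverse of
    \<open>c i\<close> and every other letter to \<open>c i\<close>. So \<open>h\<close> kills
    \<open>c i \<otimes> c j\<close>, whereas with opposite signs it would send the image of this
    product to the square of a letter.\<close>
  obtain h where h: "h \<in> hom G G" "\<And>k. k \<in> I \<Longrightarrow> h (c k) = letter (i, k \<noteq> j)"
    by (rule extend_hom[of "\<lambda>k. letter (i, k \<noteq> j)"]) (use assms(3) in auto)
  interpret h: group_hom G G h using h(1) by unfold_locales
  have "h (c i \<otimes> c j) = \<one>"
    using assms(3,4) ij letter_cancel[of "(i, True)"] by (simp add: h(2))
  moreover have "h (\<psi> (c i \<otimes> c j)) = \<one> \<longleftrightarrow> h (c i \<otimes> c j) = \<one>"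
    using assms(3,4) by (intro preserves_normal_hom_eq_one[OF assms(1) h(1)]) simp
  ultimately have "h (\<psi> (c i \<otimes> c j)) = \<one>" by (simp only:)
  moreover have "h (letter (i, s)) = letter (i, s)" "h (letter (j, t)) = letter (i, \<not> t)"
    using assms(3,4) ij h(2) inv_letter[of "(i, True)"] inv_letter[of "(i, False)"]
    by (auto simp: letter_def)
  ultimately have "letter (i, s) \<otimes> letter (i, s) = \<one>"
    using ne assms(3-6) by simp
  then show False using letter_twice[of "(i, s)"] letter_ne_one assms(3) by simp
qed

lemma preserves_normal_fixing_y_inner:
  assumes "preserves_normal G \<psi>" "\<psi> y = y"
  shows "\<exists>g\<in>carrier G. \<forall>x\<in>carrier G. \<psi> x = g \<otimes> x \<otimes> inv g"
proof -
  interpret \<psi>: group_hom G G \<psi> using assms by unfold_locales (simp add: preserves_normal_def)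
  obtain s where s: "\<forall>i\<in>I. \<psi> (c i) = letter (i, s)"
  \<comment> \<open>Without letters any sign will do; otherwise the sign is read off at one index
    \<open>k\<close>.\<close>
  proof (cases "I = {}")
    case False
    then obtain k s where k: "k \<in> I" "\<psi> (c k) = letter (k, s)"
      using preserves_normal_letter[OF assms] by blast
    have "\<psi> (c i) = letter (i, s)" if i: "i \<in> I" for i
    proof -
      obtain t where t: "\<psi> (c i) = letter (i, t)" using preserves_normal_letter[OF assms i] by blast
      then show ?thesis using preserves_normal_letter_sign[OF assms i k(1) t k(2)] by simp
    qed
    with that show thesis by blast
  qed simp
  \<comment> \<open>A common negative sign is conjugation by \<open>y\<close>, a common positive
    sign the identity.\<close>
  define g where "g = (if s then \<one> else y)"
  have g: "g \<in> carrier G" by (simp add: g_def)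
  have gen: "\<psi> h = g \<otimes> h \<otimes> inv g" if "h \<in> insert y (c ` I)" for h
    using that assms(2) s by (auto simp: g_def letter_def y_c_y)
  have "x \<in> carrier G \<and> \<psi> x = g \<otimes> x \<otimes> inv g" if "x \<in> generate G (insert y (c ` I))" for x
    using that
  proof (induction rule: generate.induct)
    case one
    then show ?case using g by simp
  next
    case (incl h)
    then show ?case using gen by auto
  next
    case (inv h)
    then have "h \<in> carrier G" by auto
    with gen[OF inv] g show ?case by (simp add: inv_mult_group m_assoc)
  next
    case (eng h1 h2)
    then show ?case using g by (simp add: m_assoc)
  qed
  then show ?thesis using g generates by blast
qed

theorem normal_automorphism_inner:
  assumes "normal_automorphism G \<phi>"
  shows "inner_automorphism G \<phi>"
proof -
  have \<phi>: "preserves_normal G \<phi>" using assms by (rule normal_automorphism_preserves_normal)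
  then have cl: "\<phi> x \<in> carrier G" if "x \<in> carrier G" for x
    using that by (auto simp: preserves_normal_def hom_def)
  obtain g where g: "g \<in> carrier G" "\<phi> y = g \<otimes> y \<otimes> inv g" using preserves_normal_y[OF \<phi>] by blast
  let ?\<psi> = "\<lambda>x. inv g \<otimes> \<phi> x \<otimes> g"
  have "?\<psi> y = y" using g by (simp add: m_assoc)
  then obtain h where h: "h \<in> carrier G" "\<And>x. x \<in> carrier G \<Longrightarrow> ?\<psi> x = h \<otimes> x \<otimes> inv h"
    using preserves_normal_fixing_y_inner[OF preserves_normal_conj[OF \<phi> g(1)]] by blast
  have "\<phi> x = (g \<otimes> h) \<otimes> x \<otimes> inv (g \<otimes> h)" if x: "x \<in> carrier G" for x
  proof -
    have "\<phi> x = g \<otimes> ?\<psi> x \<otimes> inv g" using g cl[OF x] by (simp add: m_assoc)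
    also have "\<dots> = g \<otimes> (h \<otimes> x \<otimes> inv h) \<otimes> inv g" by (simp add: h(2)[OF x])
    finally show ?thesis using g h(1) x by (simp add: inv_mult_group m_assoc)
  qed
  then show ?thesis using g h(1) by (auto simp: inner_automorphism_def)
qed

end


section \<open>The group \<open>L\<^sub>n\<close>\<close>

lemma Lwords_simps [simp]:
  "[] \<in> Lwords n"
  "j # w \<in> Lwords n \<longleftrightarrow> 1 \<le> j \<and> j < n \<and> w \<in> Lwords n"
  "u @ v \<in> Lwords n \<longleftrightarrow> u \<in> Lwords n \<and> v \<in> Lwords n"
  "rev w \<in> Lwords n \<longleftrightarrow> w \<in> Lwords n"
  by (auto simp: Lwords_def)

lemma Lrel_Lwords: "(u, v) \<in> Lrel n \<Longrightarrow> u \<in> Lwords n \<and> v \<in> Lwords n"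
  by (induction rule: Lrel.induct) auto

lemma equiv_Lrel: "equiv (Lwords n) (Lrel n)"
proof (rule equivI)
  show "Lrel n \<subseteq> Lwords n \<times> Lwords n" using Lrel_Lwords by auto
  show "refl_on (Lwords n) (Lrel n)" by (rule refl_onI) (rule Lrel.refl)
  show "sym (Lrel n)" by (rule symI) (rule Lrel.sym)
  show "trans (Lrel n)" by (rule transI) (rule Lrel.trans)
qed

lemma Lrel_context:
  "(u, v) \<in> Lrel n \<Longrightarrow> a \<in> Lwords n \<Longrightarrow> b \<in> Lwords n \<Longrightarrow> (a @ u @ b, a @ v @ b) \<in> Lrel n"
proof (induction rule: Lrel.induct)
  case (refl w)
  then show ?case by (intro Lrel.refl) simp
next
  case (sym u v)
  then show ?case using Lrel.sym by blast
next
  case (trans u v w)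
  then show ?case using Lrel.trans by blast
next
  case (invol u v j)
  then show ?case using Lrel.invol[of "a @ u" n "v @ b" j] by simp
next
  case (braid u v i)
  then show ?case using Lrel.braid[of "a @ u" n "v @ b" i] by simp
qed

abbreviation Lclass :: "nat \<Rightarrow> nat list \<Rightarrow> nat list set" where
  "Lclass n w \<equiv> Lrel n `` {w}"

lemma Lclass_eq: "(u, v) \<in> Lrel n \<Longrightarrow> Lclass n u = Lclass n v"
  by (rule equiv_class_eq[OF equiv_Lrel])

lemma Lgrp_carrier: "carrier (Lgrp n) = Lclass n ` Lwords n"
  by (auto simp: Lgrp_def quotient_def)

lemma Lgrp_one: "\<one>\<^bsub>Lgrp n\<^esub> = Lclass n []"
  by (simp add: Lgrp_def)

text \<open>The product is a union over all pairs of representatives. By \<open>Lrel_context\<close>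
  all classes in this union coincide, so it collapses to one class.\<close>

lemma Lgrp_mult:
  assumes "u \<in> Lwords n" "v \<in> Lwords n"
  shows "Lclass n u \<otimes>\<^bsub>Lgrp n\<^esub> Lclass n v = Lclass n (u @ v)"
proof -
  have const: "Lclass n (a @ b) = Lclass n (u @ v)" if "a \<in> Lclass n u" "b \<in> Lclass n v" for a b
  proof -
    have ab: "(u, a) \<in> Lrel n" "(v, b) \<in> Lrel n" using that by simp_all
    have "(u @ v, a @ v) \<in> Lrel n"
      using Lrel_context[OF ab(1), of "[]" v] assms by simp
    moreover have "(a @ v, a @ b) \<in> Lrel n"
      using Lrel_context[OF ab(2), of a "[]"] Lrel_Lwords[OF ab(1)] by simp
    ultimately have "(u @ v, a @ b) \<in> Lrel n" by (rule Lrel.trans)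
    then show ?thesis by (rule Lclass_eq[symmetric])
  qed
  have mem: "u \<in> Lclass n u" "v \<in> Lclass n v" using assms by (simp_all add: Lrel.refl)
  have UN: "(\<Union>a\<in>A. \<Union>b\<in>B. F a b) = C"
    if "\<And>a b. a \<in> A \<Longrightarrow> b \<in> B \<Longrightarrow> F a b = C" "u \<in> A" "v \<in> B"
    for F :: "nat list \<Rightarrow> nat list \<Rightarrow> nat list set" and A B C
    using that by auto
  show ?thesis unfolding Lgrp_def monoid.simps by (rule UN[OF const mem])
qed

text \<open>As generators are involutions, the reversed word represents the inverse; cancellation
  proceeds from the middle outwards.\<close>

lemma Lrel_rev_cancel: "w \<in> Lwords n \<Longrightarrow> (rev w @ w, []) \<in> Lrel n"
proof (induction w)
  case (Cons j w)
  then have "(rev w @ [j, j] @ w, rev w @ w) \<in> Lrel n" by (intro Lrel.invol) auto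
  moreover have "(rev w @ w, []) \<in> Lrel n" using Cons by simp
  ultimately have "(rev w @ [j, j] @ w, []) \<in> Lrel n" by (rule Lrel.trans)
  then show ?case by simp
qed (simp add: Lrel.refl)

lemma group_Lgrp: "group (Lgrp n)"
proof (rule groupI)
  fix x assume "x \<in> carrier (Lgrp n)"
  then obtain w where w: "w \<in> Lwords n" "x = Lclass n w" by (auto simp: Lgrp_carrier)
  show "\<exists>z\<in>carrier (Lgrp n). z \<otimes>\<^bsub>Lgrp n\<^esub> x = \<one>\<^bsub>Lgrp n\<^esub>"
    using w Lclass_eq[OF Lrel_rev_cancel[OF w(1)]]
    by (intro bexI[of _ "Lclass n (rev w)"]) (simp_all add: Lgrp_mult Lgrp_one Lgrp_carrier)
qed (auto simp: Lgrp_carrier Lgrp_mult Lgrp_one)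

section \<open>Involutions with braid relations, and the change to star generators\<close>

locale braided_involutions = group G for G (structure) +
  fixes n :: nat and Y :: "nat \<Rightarrow> 'a"
  assumes Y_closed [simp]: "1 \<le> j \<Longrightarrow> j < n \<Longrightarrow> Y j \<in> carrier G"
    and Y_Y: "1 \<le> j \<Longrightarrow> j < n \<Longrightarrow> Y j \<otimes> Y j = \<one>"
    and Y_braid: "1 \<le> i \<Longrightarrow> Suc i < n \<Longrightarrow> Y i \<otimes> Y (Suc i) \<otimes> Y i = Y (Suc i) \<otimes> Y i \<otimes> Y (Suc i)"
begin

text \<open>The universal property of the presentation: evaluation \<open>p\<close> of words is
  constant on classes, so it may be computed on a chosen representative.\<close>

lemma lift_hom: "\<exists>f\<in>hom (Lgrp n) G. \<forall>j\<in>{1..<n}. f (Lclass n [j]) = Y j"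
proof -
  define p where "p = (\<lambda>w. foldr (\<lambda>j x. Y j \<otimes> x) w \<one>)"
  have p_simps [simp]: "p [] = \<one>" "p (j # w) = Y j \<otimes> p w" for j w
    by (simp_all add: p_def)
  have p_closed [simp]: "p w \<in> carrier G" if "w \<in> Lwords n" for w
    using that by (induction w) auto
  have p_append: "p (u @ v) = p u \<otimes> p v" if "u \<in> Lwords n" "v \<in> Lwords n" for u v
    using that by (induction u) (auto simp: m_assoc)
  have p_eq: "p u = p v" if "(u, v) \<in> Lrel n" for u v
    using that
  proof (induction rule: Lrel.induct)
    case (invol u v j)
    then have j: "1 \<le> j" "j < n" by simp_all
    then have "Y j \<otimes> (Y j \<otimes> p v) = p v"
      using invol.hyps(2) Y_Y[of j] by (simp flip: m_assoc)
    then show ?case using invol.hyps(1,2) j by (simp add: p_append)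
  next
    case (braid u v i)
    then have i: "1 \<le> i" "Suc i < n" by simp_all
    then have "Y i \<otimes> (Y (Suc i) \<otimes> (Y i \<otimes> p v)) = Y (Suc i) \<otimes> (Y i \<otimes> (Y (Suc i) \<otimes> p v))"
      using braid.hyps(2) Y_braid[of i] by (simp flip: m_assoc)
    then show ?case using braid.hyps(1,2) i by (simp add: p_append)
  qed auto
  define f where "f A = p (SOME w. w \<in> A)" for A
  have f: "f (Lclass n w) = p w" if "w \<in> Lwords n" for w
  proof -
    have "w \<in> Lclass n w" using Lrel.refl[OF that] by simp
    then have "(SOME v. v \<in> Lclass n w) \<in> Lclass n w" by (rule someI)
    then have "(w, SOME v. v \<in> Lclass n w) \<in> Lrel n" by simp
    then show ?thesis unfolding f_def by (rule p_eq[symmetric])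
  qed
  have "f \<in> hom (Lgrp n) G"
    by (rule homI) (auto simp: Lgrp_carrier Lgrp_mult f p_append)
  moreover have "f (Lclass n [j]) = Y j" if "j \<in> {1..<n}" for j
    using that by (simp add: f)
  ultimately show ?thesis by blast
qed

text \<open>The element \<open>twist k\<close> is built to conjugate \<open>Y 1\<close> to
  \<open>Y (Suc k)\<close>, one neighbour at a time; see \<open>Y_conj\<close>.\<close>

primrec twist :: "nat \<Rightarrow> 'a" where
  "twist 0 = \<one>"
| "twist (Suc k) = Y (Suc k) \<otimes> Y (Suc (Suc k)) \<otimes> twist k"

text \<open>All \<open>Y\<close> are conjugate; moving the dihedral group generated by two consecutive ones into
  position over \<open>Y 1\<close> turns the line amalgam into a star amalgam.\<close>

definition rot :: "nat \<Rightarrow> 'a" where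
  "rot k = inv (twist k) \<otimes> twist (Suc k)"

lemma twist_closed [simp]: "Suc k < n \<Longrightarrow> twist k \<in> carrier G"
  by (induction k) auto

lemma rot_closed [simp]: "k < n - 2 \<Longrightarrow> rot k \<in> carrier G"
  using twist_closed[of k] twist_closed[of "Suc k"] by (simp add: rot_def)

lemma twist_Suc: "k < n - 2 \<Longrightarrow> twist (Suc k) = twist k \<otimes> rot k"
  using twist_closed[of k] twist_closed[of "Suc k"] by (simp add: rot_def del: twist.simps)

lemma Y_Y_left: "1 \<le> j \<Longrightarrow> j < n \<Longrightarrow> x \<in> carrier G \<Longrightarrow> Y j \<otimes> (Y j \<otimes> x) = x"
  using Y_Y[of j] by (simp flip: m_assoc)

lemma inv_Y: "1 \<le> j \<Longrightarrow> j < n \<Longrightarrow> inv (Y j) = Y j"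
  using Y_Y[of j] by (simp add: inv_equality)

lemma Y_braid_left:
  assumes "1 \<le> i" "Suc i < n" "x \<in> carrier G"
  shows "Y i \<otimes> (Y (Suc i) \<otimes> (Y i \<otimes> x)) = Y (Suc i) \<otimes> (Y i \<otimes> (Y (Suc i) \<otimes> x))"
  using assms Y_braid[of i] by (simp flip: m_assoc)

text \<open>For neighbours \<open>a\<close> and \<open>b\<close>, the braid relation and the
  involutions give \<open>a b a b a = b\<close>, so \<open>a b\<close> conjugates \<open>a\<close>
  to \<open>b\<close>.\<close>

lemma Y_conj: "Suc k < n \<Longrightarrow> Y (Suc k) = twist k \<otimes> Y 1 \<otimes> inv (twist k)"
proof (induction k)
  case (Suc k)
  let ?a = "Y (Suc k)" and ?b = "Y (Suc (Suc k))"
  have ab: "?a \<in> carrier G" "?b \<in> carrier G" "twist k \<in> carrier G" "Y 1 \<in> carrier G"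
    using Suc.prems by simp_all
  have "twist (Suc k) \<otimes> Y 1 \<otimes> inv (twist (Suc k)) =
      ?a \<otimes> ?b \<otimes> (twist k \<otimes> Y 1 \<otimes> inv (twist k)) \<otimes> inv ?b \<otimes> inv ?a"
    using ab by (simp add: inv_mult_group m_assoc)
  also have "twist k \<otimes> Y 1 \<otimes> inv (twist k) = ?a"
    by (rule Suc.IH[symmetric]) (use Suc.prems in simp)
  also have "?a \<otimes> ?b \<otimes> ?a \<otimes> inv ?b \<otimes> inv ?a = ?a \<otimes> (?b \<otimes> (?a \<otimes> (?b \<otimes> ?a)))"
    using ab Suc.prems by (simp add: inv_Y m_assoc)
  also have "\<dots> = ?b"
    using ab Suc.prems by (simp add: Y_braid_left Y_Y Y_Y_left)
  finally show ?case by simp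
qed simp

lemma rot_eq: "k < n - 2 \<Longrightarrow> rot k = inv (twist k) \<otimes> (Y (Suc k) \<otimes> (Y (Suc (Suc k)) \<otimes> twist k))"
  by (simp add: rot_def m_assoc)

lemma Y_1_conj: "Suc k < n \<Longrightarrow> Y 1 = inv (twist k) \<otimes> (Y (Suc k) \<otimes> twist k)"
  by (simp add: Y_conj[of k] m_assoc)

text \<open>Up to conjugation by \<open>twist i\<close>, \<open>Y 1\<close> and \<open>rot i\<close>
  are \<open>a\<close> and \<open>a b\<close> for the neighbours \<open>a = Y (Suc i)\<close> and
  \<open>b = Y (Suc (Suc i))\<close>. The braid relation gives \<open>a b\<close> trivial cube, and
  \<open>a\<close> inverts it.\<close>

lemma inverted_rot:
  assumes "n \<ge> 2"
  shows "inverted_letters G {..<n - 2} (Y 1) rot"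
proof
  fix i assume "i \<in> {..<n - 2}"
  then have i: "i < n - 2" "Suc i < n" "Suc (Suc i) < n" by auto
  have cl: "Y (Suc i) \<in> carrier G" "Y (Suc (Suc i)) \<in> carrier G" "twist i \<in> carrier G"
    using i by simp_all
  show "rot i \<in> carrier G" using i by simp
  show "rot i \<otimes> rot i \<otimes> rot i = \<one>"
    using cl i by (simp add: rot_eq m_assoc Y_braid_left Y_Y_left)
  show "Y 1 \<otimes> rot i \<otimes> Y 1 = inv (rot i)"
    using cl i by (simp add: rot_eq Y_1_conj[OF i(2)] m_assoc Y_Y_left inv_mult_group inv_Y
        del: One_nat_def)
qed (use assms Y_Y[of 1] in auto)

end

text \<open>The converse change of generators, from star back to line. With \<open>lift_hom\<close>
  it yields the universal property of \<open>L_n\<close> in terms of \<open>y\<close> and the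
  rotations.\<close>

lemma inverted_letters_braided:
  fixes G (structure)
  assumes "inverted_letters G {..<n - 2} y d"
  shows "\<exists>Y. braided_involutions G n Y \<and> Y 1 = y \<and>
    (\<forall>k<n - 2. braided_involutions.rot G Y k = d k)"
proof -
  interpret inverted_letters G "{..<n - 2}" y d by fact
  \<comment> \<open>By \<open>twist_Suc\<close>, \<open>twist k\<close> has to be the product of the
    first \<open>k\<close> rotations; \<open>Y_conj\<close> then dictates \<open>Y\<close>, with the
    shift \<open>j - 1\<close> because generators are numbered from 1.\<close>
  define t where "t = rec_nat \<one> (\<lambda>k x. x \<otimes> d k)"
  have t_simps: "t 0 = \<one>" "t (Suc k) = t k \<otimes> d k" for k by (simp_all add: t_def)
  have t [simp]: "t k \<in> carrier G" if "k \<le> n - 2" for k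
    using that by (induction k) (simp_all add: t_simps)
  define Y where "Y j = t (j - 1) \<otimes> y \<otimes> inv (t (j - 1))" for j
  have yd: "d k \<otimes> y = y \<otimes> inv (d k)" "inv (d k) \<otimes> y = y \<otimes> d k"
    and dd: "inv (d k) \<otimes> inv (d k) = d k" if "k < n - 2" for k
    using that y_letter[of "(k, True)"] y_letter[of "(k, False)"] letter_twice[of "(k, False)"]
    by (simp_all add: letter_def)
  \<comment> \<open>Expressing both neighbours through the same \<open>t k\<close> reduces the braid
    relation to the dihedral group generated by \<open>y\<close> and \<open>d k\<close>.\<close>
  have Y_Suc: "Y (Suc (Suc k)) = t k \<otimes> y \<otimes> d k \<otimes> inv (t k)" if "k < n - 2" for k
  proof -
    have "Y (Suc (Suc k)) = t k \<otimes> (d k \<otimes> y) \<otimes> inv (d k) \<otimes> inv (t k)"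
      using that by (simp add: Y_def t_simps inv_mult_group m_assoc)
    also have "\<dots> = t k \<otimes> y \<otimes> (inv (d k) \<otimes> inv (d k)) \<otimes> inv (t k)"
      using that by (simp add: yd m_assoc)
    finally show ?thesis using that by (simp add: dd)
  qed
  have "braided_involutions G n Y"
  proof
    fix j assume "1 \<le> j" "j < n"
    then show "Y j \<in> carrier G" "Y j \<otimes> Y j = \<one>" by (simp_all add: Y_def m_assoc)
  next
    fix i assume i: "1 \<le> i" "Suc i < n"
    then obtain k where k: "i = Suc k" "k < n - 2" by (cases i) auto
    have Y_i: "Y (Suc k) = t k \<otimes> y \<otimes> inv (t k)" by (simp add: Y_def)
    have dyx: "d k \<otimes> (y \<otimes> x) = y \<otimes> (inv (d k) \<otimes> x)"
      and ddx: "d k \<otimes> (d k \<otimes> x) = inv (d k) \<otimes> x" if "x \<in> carrier G" for x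
      using that k yd(1)[of k] letter_twice[of "(k, True)"]
      by (simp_all add: letter_def flip: m_assoc)
    have idyx: "inv (d k) \<otimes> (y \<otimes> x) = y \<otimes> (d k \<otimes> x)" if "x \<in> carrier G" for x
      using that k yd(2)[of k] by (simp flip: m_assoc)
    show "Y i \<otimes> Y (Suc i) \<otimes> Y i = Y (Suc i) \<otimes> Y i \<otimes> Y (Suc i)"
      using k by (simp add: Y_i Y_Suc m_assoc dyx ddx idyx)
  qed
  then interpret Y: braided_involutions G n Y .
  have twist: "Y.twist k = t k" if "k \<le> n - 2" for k
    using that
  proof (induction k)
    case (Suc k)
    then have k: "k < n - 2" by simp
    have "Y.twist (Suc k) = (t k \<otimes> y \<otimes> inv (t k)) \<otimes> (t k \<otimes> y \<otimes> d k \<otimes> inv (t k)) \<otimes> t k"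
      using Suc k by (simp add: Y_Suc) (simp add: Y_def)
    also have "\<dots> = t (Suc k)" using k by (simp add: t_simps m_assoc)
    finally show ?case .
  qed (simp add: t_simps)
  have "Y.rot k = d k" if "k < n - 2" for k
    using that by (simp add: Y.rot_def twist t_simps del: Y.twist.simps)
  moreover have "Y 1 = y" by (simp add: Y_def t_simps)
  ultimately show ?thesis using Y.braided_involutions_axioms by blast
qed

section \<open>\<open>L_n\<close> as a free instance\<close>

lemma braided_Lgrp: "braided_involutions (Lgrp n) n (\<lambda>j. Lclass n [j])"
proof -
  interpret group "Lgrp n" by (rule group_Lgrp)
  show ?thesis
  proof
    fix j assume "1 \<le> j" "j < n"
    then show "Lclass n [j] \<in> carrier (Lgrp n)"
      "Lclass n [j] \<otimes>\<^bsub>Lgrp n\<^esub> Lclass n [j] = \<one>\<^bsub>Lgrp n\<^esub>"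
      using Lrel.invol[of "[]" n "[]" j]
      by (auto simp: Lgrp_carrier Lgrp_mult Lgrp_one intro!: Lclass_eq)
  next
    fix i assume "1 \<le> i" "Suc i < n"
    then show "Lclass n [i] \<otimes>\<^bsub>Lgrp n\<^esub> Lclass n [Suc i] \<otimes>\<^bsub>Lgrp n\<^esub> Lclass n [i] =
        Lclass n [Suc i] \<otimes>\<^bsub>Lgrp n\<^esub> Lclass n [i] \<otimes>\<^bsub>Lgrp n\<^esub> Lclass n [Suc i]"
      using Lrel.braid[of "[]" n "[]" i] by (auto simp: Lgrp_mult intro!: Lclass_eq)
  qed
qed

lemma free_inverted_letters_Lgrp:
  assumes "n \<ge> 2"
  shows "free_inverted_letters (Lgrp n) {..<n - 2} (Lclass n [1])
    (braided_involutions.rot (Lgrp n) (\<lambda>j. Lclass n [j]))"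
proof -
  interpret L: braided_involutions "Lgrp n" n "\<lambda>j. Lclass n [j]" by (rule braided_Lgrp)
  interpret inverted_letters "Lgrp n" "{..<n - 2}" "Lclass n [1]" L.rot
    using L.inverted_rot[OF assms] .
  \<comment> \<open>Proved for a target of arbitrary type, since it is applied both to
    \<open>red_perms\<close> and to \<open>Lgrp n\<close>.\<close>
  have extend: "\<exists>f\<in>hom (Lgrp n) H. f (Lclass n [1]) = y \<and> (\<forall>i\<in>{..<n - 2}. f (L.rot i) = d i)"
    if "inverted_letters H {..<n - 2} y d" for H :: "('b, 'c) monoid_scheme" and y d
  proof -
    interpret H: inverted_letters H "{..<n - 2}" y d by fact
    obtain Y where Y: "braided_involutions H n Y" "Y 1 = y"
      "\<And>k. k < n - 2 \<Longrightarrow> braided_involutions.rot H Y k = d k"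
      using inverted_letters_braided[OF H.inverted_letters_axioms] by blast
    interpret Y: braided_involutions H n Y by fact
    obtain f where f: "f \<in> hom (Lgrp n) H" "\<And>j. 1 \<le> j \<Longrightarrow> j < n \<Longrightarrow> f (Lclass n [j]) = Y j"
      using Y.lift_hom by auto
    interpret f: group_hom "Lgrp n" H f using f(1) by unfold_locales
    have twist: "f (L.twist k) = Y.twist k" if "Suc k < n" for k
      using that
    proof (induction k)
      case (Suc k)
      then show ?case using L.twist_closed[of k] L.Y_closed[of "Suc k"] L.Y_closed[of "Suc (Suc k)"]
        by (simp add: f(2) del: L.Y_closed)
    qed simp
    have "f (L.rot k) = d k" if "k < n - 2" for k
      using that L.twist_closed[of k] L.twist_closed[of "Suc k"] twist[of k] twist[of "Suc k"] Y(3)[of k]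
      by (simp add: L.rot_def Y.rot_def del: L.twist.simps Y.twist.simps)
    moreover have "f (Lclass n [1]) = y" using f(2)[of 1] Y(2) assms by simp
    ultimately show ?thesis using f(1) by auto
  qed
  let ?S = "generate (Lgrp n) (insert (Lclass n [1]) (L.rot ` {..<n - 2}))"
  have S: "subgroup ?S (Lgrp n)"
    using y_closed by (intro L.generate_is_subgroup) auto
  \<comment> \<open>The rotations recover the twists by \<open>twist_Suc\<close>, and the twists
    recover all generators from the first by \<open>Y_conj\<close>.\<close>
  have twist: "L.twist k \<in> ?S" if "Suc k < n" for k
    using that
  proof (induction k)
    case (Suc k)
    then have "L.twist k \<in> ?S" "L.rot k \<in> ?S"
      by (simp, intro generate.incl insertI2 imageI) simp
    then have "L.twist k \<otimes>\<^bsub>Lgrp n\<^esub> L.rot k \<in> ?S" by (rule generate.eng)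
    then show ?case using Suc.prems L.twist_Suc[of k] by (simp del: L.twist.simps)
  qed (simp add: generate.one)
  have Y: "Lclass n [j] \<in> ?S" if j: "1 \<le> j" "j < n" for j
  proof -
    obtain k where k: "j = Suc k" "Suc k < n" using j by (cases j) auto
    have "L.twist k \<otimes>\<^bsub>Lgrp n\<^esub> Lclass n [1] \<otimes>\<^bsub>Lgrp n\<^esub> inv\<^bsub>Lgrp n\<^esub> L.twist k \<in> ?S"
      by (intro generate.eng subgroup.m_inv_closed[OF S] twist[OF k(2)] generate.incl insertI1)
    then show ?thesis using L.Y_conj[OF k(2)] k(1) by simp
  qed
  have "Lclass n w \<in> ?S" if "w \<in> Lwords n" for w
    using that
  proof (induction w)
    case Nil
    then show ?case using generate.one[of "Lgrp n"] by (simp add: Lgrp_one)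
  next
    case (Cons j w)
    then have "Lclass n [j] \<otimes>\<^bsub>Lgrp n\<^esub> Lclass n w \<in> ?S" by (intro generate.eng Y) auto
    then show ?case using Cons.prems by (simp add: Lgrp_mult)
  qed
  then have "carrier (Lgrp n) = ?S"
    using subgroup.subset[OF S] by (auto simp: Lgrp_carrier)
  then show ?thesis
    using extend[OF red_inverted_letters] extend[of "Lgrp n"] by unfold_locales
qed

theorem theorem5p6:
  fixes n :: nat and \<phi> :: "nat list set \<Rightarrow> nat list set"
  assumes "n \<ge> 2"
    and "normal_automorphism (Lgrp n) \<phi>"
  shows "inner_automorphism (Lgrp n) \<phi>"
  using free_inverted_letters.normal_automorphism_inner[OF free_inverted_letters_Lgrp[OF assms(1)] assms(2)] .

end
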